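(* Let $q=2^m$ and let $\rho(x)\in K[x]$ be a polynomial with $\rho(u)\in F\setminus\{0\}$ for all $u\in S$. Let $H=\{u\rho(u): u\in S\}\cup\{0\}$ and let $$\mathscr{M}=\{(i,k): 1\le k\le q-2,\ 0\le i\le \lfloor (k-1)/2\rfloor,\ i\preceq k\}.$$ Then the following are equivalent: (a) $H$ is a hyperoval; (b) for each $(i,k)\in\mathscr{M}$, the coefficient of $x^{2i-k+q+1}$ in $\rho(x)^{k}\bmod (x^{q+1}-1)$ is zero; (c) for each $(i,k)\in\mathscr{M}$, the coefficient of $x^{k-2i}$ in $\rho(x)^{k}\bmod (x^{q+1}-1)$ is zero. Here $f(x)\bmod (x^{q+1}-1)$ denotes the remainder of $f$ upon division by $x^{q+1}-1$.
   Context: Let $q=2^m$, $F=\mathbb{F}_q$, $K=\mathbb{F}_{q^2}$, and for $x\in K$ write $\bar x=x^q$. Let $S=\{u\in K: u^{q+1}=1\}$ and define the $F$-valued bilinear form $\langle x,y\rangle=x\bar y+\bar x y$ on $K$. The affine plane $AG(2,q)$ is identified with $K$: its points are the elements of $K$ and its lines are the sets $L(u,\mu)=\{x\in K:\langle u,x\rangle+\mu=0\}$ with $u\in S$, $\mu\in F$. A hyperoval is a set of $q+2$ points of $K$, no three of which lie on a common line. For nonnegative integers $b=\sum_j b_j2^j$, $c=\sum_j c_j2^j$ with $b_j,c_j\in\{0,1\}$, write $b\preceq c$ if $b_j\le c_j$ for all $j$. *)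

theory Defs
  imports "HOL-Computational_Algebra.Polynomial" "HOL-Library.Cardinality"
begin

text \<open>The field \<open>K\<close> of order \<open>q\<^sup>2\<close> is a type \<open>'a\<close> of class field and finite with
  \<open>CARD('a) = q\<^sup>2\<close>; its subfield \<open>F\<close> of order \<open>q\<close> is the fixed set of the Frobenius map
  \<open>x \<mapsto> x ^ q\<close>.\<close>

definition subfield_F :: "nat \<Rightarrow> 'a::field set" where
  "subfield_F q = {x. x ^ q = x}"

definition conj_K :: "nat \<Rightarrow> 'a::field \<Rightarrow> 'a" where
  "conj_K q x = x ^ q"

definition unit_circle :: "nat \<Rightarrow> 'a::field set" where
  "unit_circle q = {u. u ^ (q + 1) = 1}"

definition form_K :: "nat \<Rightarrow> 'a::field \<Rightarrow> 'a \<Rightarrow> 'a" where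
  "form_K q x y = x * conj_K q y + conj_K q x * y"

definition line :: "nat \<Rightarrow> 'a::field \<Rightarrow> 'a \<Rightarrow> 'a set" where
  "line q u \<mu> = {x. form_K q u x + \<mu> = 0}"

definition lines :: "nat \<Rightarrow> 'a::field set set" where
  "lines q = {line q u \<mu> | u \<mu>. u \<in> unit_circle q \<and> \<mu> \<in> subfield_F q}"

definition hyperoval :: "nat \<Rightarrow> 'a::field set \<Rightarrow> bool" where
  "hyperoval q H \<longleftrightarrow> card H = q + 2 \<and>
     (\<forall>x\<in>H. \<forall>y\<in>H. \<forall>z\<in>H. x \<noteq> y \<and> y \<noteq> z \<and> x \<noteq> z \<longrightarrow>
        \<not> (\<exists>L\<in>lines q. x \<in> L \<and> y \<in> L \<and> z \<in> L))"

definition digit_le :: "nat \<Rightarrow> nat \<Rightarrow> bool" where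
  "digit_le b c \<longleftrightarrow> (\<forall>j. bit b j \<longrightarrow> bit c j)"

definition point_set :: "nat \<Rightarrow> 'a::field poly \<Rightarrow> 'a set" where
  "point_set q \<rho> = {u * poly \<rho> u | u. u \<in> unit_circle q} \<union> {0}"

text \<open>No natural-number subtraction truncates: \<open>k - 1\<close> is used only with \<open>k \<ge> 1\<close>, and \<open>q \<ge> 2\<close>
  since \<open>q\<close> is the order of a field.\<close>

definition index_set :: "nat \<Rightarrow> (nat \<times> nat) set" where
  "index_set q = {(i, k). 1 \<le> k \<and> k \<le> q - 2 \<and> i \<le> (k - 1) div 2 \<and> digit_le i k}"

definition modulus_poly :: "nat \<Rightarrow> 'a::field poly" where
  "modulus_poly q = monom 1 (q + 1) - 1"

end

theory Submission
  imports Defs "HOL-Computational_Algebra.Primes"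
begin

text \<open>Since no two points of \<open>H\<close> other than 0 are collinear with 0, \<open>|H| = q + 2\<close>; counting lines
  through the points of \<open>H\<close> shows that \<open>H\<close> is a hyperoval if and only if every line meets it in an
  even number of points. For the lines with direction \<open>u\<close> that miss 0 this says that the function
  \<open>v \<mapsto> \<rho>(v)\<langle>u,v\<rangle>\<close> on \<open>S\<close> attains each nonzero value an even number of times, which in
  characteristic 2 means that its \<open>k\<close>-th power sums vanish for \<open>1 \<le> k \<le> q - 2\<close>. Expanding
  \<open>\<langle>u,v\<rangle>\<^sup>k\<close> binomially turns such a power sum into a Laurent polynomial in \<open>u\<close> whose exponents
  \<open>2i - k\<close> are distinct modulo \<open>q + 1\<close>, and in which only the \<open>i \<preceq> k\<close> survive; so all its
  coefficients \<open>\<Sum>\<^sub>v \<rho>(v)\<^sup>k v\<^bsup>k-2i\<^esup>\<close> vanish. By orthogonality on \<open>S\<close> this coefficient is the one of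
  \<open>x\<^bsup>2i-k\<^esup>\<close> in \<open>\<rho>\<^sup>k mod (x\<^bsup>q+1\<^esup> - 1)\<close>. The involution \<open>i \<mapsto> k - i\<close> corresponds to conjugation,
  which reduces the range of \<open>i\<close> by half and exchanges the two families of coefficients.\<close>

section \<open>Roots of unity in a finite field\<close>

text \<open>Multiplication by \<open>x\<close> permutes the nonzero elements, so their product can
  be cancelled.\<close>

lemma finite_field_power_card_minus_one:
  fixes x :: "'a::{field,finite}"
  assumes "x \<noteq> 0"
  shows "x ^ (CARD('a) - 1) = 1"
proof -
  have "bij_betw ((*) x) (UNIV - {0}) (UNIV - {0})"
    using assms by (intro bij_betw_byWitness[where f' = "\<lambda>y. y / x"]) auto
  then have "(\<Prod>y\<in>UNIV - {0}. x * y) = \<Prod>(UNIV - {0})"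
    by (rule prod.reindex_bij_betw)
  then show ?thesis
    by (simp add: prod.distrib card_Diff_singleton)
qed

lemma card_power_fibre_le:
  fixes c :: "'a::idom"
  assumes "n > 0"
  shows "card {x. x ^ n = c} \<le> n"
proof -
  let ?p = "monom 1 n - [:c:]"
  have "coeff ?p n = 1"
    using assms by (simp add: coeff_eq_0)
  then have "?p \<noteq> 0"
    by (metis coeff_0 zero_neq_one)
  moreover have "degree ?p \<le> n"
    by (intro degree_diff_le) (auto simp: degree_monom_le)
  moreover have "{x. x ^ n = c} = {x. poly ?p x = 0}"
    by (simp add: poly_monom)
  ultimately show ?thesis
    using card_poly_roots_bound[of ?p] by simp
qed

text \<open>The lower bound comes from counting instead of cyclicity: the \<open>e\<close>-th power
  map sends the nonzero elements to \<open>d\<close>-th roots of unity, with fibres of size at most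
  \<open>e\<close>.\<close>

lemma card_roots_of_unity_finite_field:
  assumes "d * e = CARD('a::{field,finite}) - 1"
  shows "card {x::'a. x ^ d = 1} = d"
proof (rule antisym)
  have "card {0, 1 :: 'a} \<le> CARD('a)"
    by (intro card_mono) auto
  then have "0 < d * e"
    using assms by simp
  then have pos: "d > 0" "e > 0"
    by auto
  then show "card {x::'a. x ^ d = 1} \<le> d"
    by (intro card_power_fibre_le)
  have "(UNIV - {0 :: 'a}) \<subseteq> (\<Union>y\<in>{x. x ^ d = 1}. {x. x ^ e = y})"
    using finite_field_power_card_minus_one[where 'a = 'a, folded assms]
    by (fastforce simp: mult.commute[of d] simp flip: power_mult)
  then have "card (UNIV - {0 :: 'a}) \<le> card (\<Union>y\<in>{x::'a. x ^ d = 1}. {x. x ^ e = y})"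
    by (intro card_mono) auto
  also have "\<dots> \<le> (\<Sum>y\<in>{x::'a. x ^ d = 1}. card {x. x ^ e = y})"
    by (rule card_UN_le) simp
  also have "\<dots> \<le> (\<Sum>y\<in>{x::'a. x ^ d = 1}. e)"
    by (intro sum_mono card_power_fibre_le pos)
  finally have "d * e \<le> card {x::'a. x ^ d = 1} * e"
    by (simp add: assms card_Diff_singleton)
  then show "d \<le> card {x::'a. x ^ d = 1}"
    using pos by simp
qed

lemma power_eq_of_dvd:
  fixes x :: "'a::field"
  assumes "x ^ d = 1" and "int d dvd int s - int t"
  shows "x ^ s = x ^ t"
proof -
  have *: "x ^ n = x ^ (n mod d)" for n
  proof -
    have "x ^ n = x ^ (d * (n div d) + n mod d)"
      by simp
    then show ?thesis
      unfolding power_add power_mult using assms(1) by simp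
  qed
  have "s mod d = t mod d"
    using assms(2) by (metis mod_eq_dvd_iff of_nat_eq_iff zmod_int)
  then show ?thesis
    using * by metis
qed

lemma eq_if_int_dvd_diff:
  assumes "int d dvd int i - int j" "i < d" "j < d"
  shows "i = j"
  using assms by (metis mod_eq_dvd_iff mod_less of_nat_eq_iff zmod_int)

text \<open>Orthogonality: if \<open>d\<close> does not divide \<open>t\<close>, some root
  \<open>w\<close> has \<open>w ^ t\<close> different from 1, and multiplication by \<open>w\<close>
  permutes the roots while scaling the sum by \<open>w ^ t\<close>.\<close>

lemma sum_power_roots_of_unity:
  assumes "d * e = CARD('a::{field,finite}) - 1"
  shows "(\<Sum>x | x ^ d = 1. x ^ t) = (if d dvd t then of_nat d else (0::'a))"
proof (cases "d dvd t")
  case True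
  then have "x ^ t = 1" if "x ^ d = 1" for x :: 'a
    using that by (auto elim!: dvdE simp: power_mult)
  then show ?thesis
    using True by (simp add: card_roots_of_unity_finite_field[OF assms])
next
  case False
  \<comment> \<open>The root count must use an exponent below \<open>d\<close>, so that fewer than
    \<open>d\<close> elements satisfy \<open>x ^ r = 1\<close>.\<close>
  define r where "r = t mod d"
  have "card {0, 1 :: 'a} \<le> CARD('a)"
    by (intro card_mono) auto
  then have "d > 0"
    using assms by (cases "d = 0") auto
  then have "0 < r" "r < d"
    using False by (auto simp: r_def mod_greater_zero_iff_not_dvd)
  then have "card {x::'a. x ^ r = 1} < card {x::'a. x ^ d = 1}"
    using card_power_fibre_le[of r "1::'a"] card_roots_of_unity_finite_field[OF assms] by linarith
  then have "\<not> {x::'a. x ^ d = 1} \<subseteq> {x. x ^ r = 1}"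
    by (meson card_mono finite leD)
  then obtain w :: 'a where w: "w ^ d = 1" "w ^ r \<noteq> 1"
    by auto
  have "w ^ t = w ^ r"
    using w(1) by (rule power_eq_of_dvd) (simp add: r_def zmod_int flip: mod_eq_dvd_iff)
  with w have wt: "w ^ t \<noteq> 1"
    by simp
  have "w \<noteq> 0"
    using w \<open>d > 0\<close> by (auto simp: power_0_left)
  then have "bij_betw ((*) w) {x. x ^ d = 1} {x. x ^ d = 1}"
    using w by (intro bij_betw_byWitness[where f' = "\<lambda>y. y / w"])
      (auto simp: power_mult_distrib power_divide)
  then have "(\<Sum>x | x ^ d = 1. (w * x) ^ t) = (\<Sum>x | x ^ d = 1. x ^ t)"
    by (rule sum.reindex_bij_betw)
  then have "w ^ t * (\<Sum>x | x ^ d = 1. x ^ t) = (\<Sum>x | x ^ d = 1. x ^ t)"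
    by (simp add: power_mult_distrib sum_distrib_left)
  with wt have "(\<Sum>x | x ^ d = 1. x ^ t) = (0 :: 'a)"
    by simp
  with False show ?thesis
    by simp
qed

lemma of_nat_card_finite_field: "of_nat CARD('a::{field,finite}) = (0::'a)"
proof -
  have "bij_betw ((+) 1) (UNIV :: 'a set) UNIV"
    by (intro bij_betw_byWitness[where f' = "\<lambda>y. y - 1"]) auto
  then have "(\<Sum>x\<in>(UNIV :: 'a set). 1 + x) = \<Sum>UNIV"
    by (rule sum.reindex_bij_betw)
  then show ?thesis
    by (simp add: sum.distrib)
qed

text \<open>A sum of powers with exponents distinct modulo \<open>d\<close> that vanishes on all
  \<open>d\<close>-th roots of unity has zero coefficients, by orthogonality.\<close>

lemma independent_powers_roots_of_unity:
  fixes c :: "'i \<Rightarrow> 'a::{field,finite}"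
  assumes de: "d * e = CARD('a) - 1"
    and I: "finite I"
    and inj: "\<And>i j. i \<in> I \<Longrightarrow> j \<in> I \<Longrightarrow> int d dvd int (n i) - int (n j) \<Longrightarrow> i = j"
    and zero: "\<And>x. x ^ d = 1 \<Longrightarrow> (\<Sum>i\<in>I. c i * x ^ n i) = 0"
    and j: "j \<in> I"
  shows "c j = 0"
proof -
  have "card {0, 1 :: 'a} \<le> CARD('a)"
    by (intro card_mono) auto
  then have d: "d > 0" and "CARD('a) = Suc (d * e)"
    using de by (cases "d = 0"; simp)+
  \<comment> \<open>In the field this reads d * e = -1, so \<open>d\<close> is invertible
    there.\<close>
  then have "of_nat (Suc (d * e)) = (0::'a)"
    using of_nat_card_finite_field[where 'a = 'a] by simp
  then have "of_nat d \<noteq> (0::'a)"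
    by auto
  have dvd_iff: "d dvd n i + (d - 1) * n j \<longleftrightarrow> i = j" if "i \<in> I" for i
  proof -
    have "int (n i + (d - 1) * n j) = int d * int (n j) + (int (n i) - int (n j))"
      using d by (cases d) (simp_all add: algebra_simps)
    then have "d dvd n i + (d - 1) * n j \<longleftrightarrow> int d dvd int (n i) - int (n j)"
      by (metis dvd_add_right_iff dvd_triv_left int_dvd_int_iff)
    then show ?thesis
      using inj that j by auto
  qed
  \<comment> \<open>On \<open>d\<close>-th roots of unity the factor
    \<open>x ^ ((d - 1) * n j)\<close> is the inverse of \<open>x ^ n j\<close>; summing isolates
    \<open>c j\<close>.\<close>
  have "0 = (\<Sum>x | x ^ d = 1. (\<Sum>i\<in>I. c i * x ^ n i) * x ^ ((d - 1) * n j))"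
    using zero by simp
  also have "\<dots> = (\<Sum>x | x ^ d = 1. \<Sum>i\<in>I. c i * x ^ (n i + (d - 1) * n j))"
    by (simp add: sum_distrib_right power_add mult.assoc)
  also have "\<dots> = (\<Sum>i\<in>I. c i * (\<Sum>x | x ^ d = 1. x ^ (n i + (d - 1) * n j)))"
    by (subst sum.swap) (simp add: sum_distrib_left)
  also have "\<dots> = (\<Sum>i\<in>I. if i = j then c i * of_nat d else 0)"
    by (intro sum.cong) (simp_all add: sum_power_roots_of_unity[OF de] dvd_iff del: One_nat_def)
  also have "\<dots> = c j * of_nat d"
    using I j by simp
  finally show ?thesis
    using \<open>of_nat d \<noteq> 0\<close> by simp
qed


section \<open>Parity of binomial coefficients\<close>

text \<open>Two applications of Pascal's rule produce the middle term twice. Together with the next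
  lemma this is (1 + x)^(2n) = (1 + x^2)^n modulo 2.\<close>

lemma even_double_choose_odd: "even ((2 * n) choose Suc (2 * k))"
proof (induction n arbitrary: k)
  case (Suc n)
  show ?case
    using Suc[of k] Suc[of "k - 1"] by (cases k) auto
qed simp

lemma odd_double_choose_double: "odd ((2 * n) choose (2 * k)) \<longleftrightarrow> odd (n choose k)"
proof (induction n arbitrary: k)
  case 0
  show ?case by (cases k) auto
next
  case (Suc n)
  show ?case
    using Suc[of k] Suc[of "k - 1"] by (cases k) auto
qed

lemma digit_le_double [simp]:
  "digit_le (2 * a) (2 * b) \<longleftrightarrow> digit_le a b"
  "digit_le (2 * a) (Suc (2 * b)) \<longleftrightarrow> digit_le a b"
  "digit_le (Suc (2 * a)) (Suc (2 * b)) \<longleftrightarrow> digit_le a b"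
  "\<not> digit_le (Suc (2 * a)) (2 * b)"
proof -
  have all_nat: "(\<forall>j. P j) \<longleftrightarrow> P 0 \<and> (\<forall>j. P (Suc j))" for P
    by (metis not0_implies_Suc)
  show "digit_le (2 * a) (2 * b) \<longleftrightarrow> digit_le a b"
    "digit_le (2 * a) (Suc (2 * b)) \<longleftrightarrow> digit_le a b"
    "digit_le (Suc (2 * a)) (Suc (2 * b)) \<longleftrightarrow> digit_le a b"
    "\<not> digit_le (Suc (2 * a)) (2 * b)"
    unfolding digit_le_def by (subst all_nat; simp add: bit_Suc bit_0)+
qed

text \<open>The lowest 1 of \<open>i\<close> stands where \<open>2 * i\<close> has a 0. This
  excludes the middle index when \<open>k = 2 * i\<close>.\<close>

lemma not_digit_le_double: "i > 0 \<Longrightarrow> \<not> digit_le i (2 * i)"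
proof (induction i rule: nat_bit_induct)
  case (even i)
  then show ?case
    using digit_le_double(1)[of i "2 * i"] by blast
next
  case (odd i)
  show ?case
    using digit_le_double(4)[of i "Suc (2 * i)"] by blast
qed simp

text \<open>Lucas's theorem for the prime 2, by stripping the last binary digit.\<close>

lemma odd_choose_iff_digit_le: "odd (k choose i) \<longleftrightarrow> digit_le i k"
proof (induction k arbitrary: i rule: nat_bit_induct)
  case zero
  have "digit_le i 0 \<longleftrightarrow> i = 0"
    unfolding digit_le_def by (auto intro: bit_eqI)
  then show ?case
    by (cases i) auto
next
  case (even k)
  show ?case
  proof (cases "even i")
    case True
    then obtain j where "i = 2 * j" by (elim evenE)
    then show ?thesis
      using even(1)[of j] by (simp add: odd_double_choose_double)
  next
    case False
    then obtain j where "i = Suc (2 * j)" by (elim oddE) auto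
    then show ?thesis
      using even_double_choose_odd[of k j] by simp
  qed
next
  case (odd k)
  show ?case
  proof (cases "even i")
    case True
    then obtain j where i: "i = 2 * j" by (elim evenE)
    have "odd (Suc (2 * k) choose (2 * j)) \<longleftrightarrow> odd ((2 * k) choose (2 * j))"
      using even_double_choose_odd[of k "j - 1"] by (cases j) simp_all
    then show ?thesis
      using odd[of j] odd_double_choose_double[of k j] by (simp only: i digit_le_double)
  next
    case False
    then obtain j where i: "i = Suc (2 * j)" by (elim oddE) auto
    have "odd (Suc (2 * k) choose Suc (2 * j)) \<longleftrightarrow> odd ((2 * k) choose (2 * j))"
      using even_double_choose_odd[of k j] by simp
    then show ?thesis
      using odd[of j] odd_double_choose_double[of k j] by (simp only: i digit_le_double)
  qed
qed


section \<open>The affine plane on a field of order \<open>q\<^sup>2\<close>\<close>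

locale even_square_field =
  fixes q m :: nat and K :: "'a::{field,finite} itself"
  assumes q_eq: "q = 2 ^ m" and card_K: "CARD('a) = q\<^sup>2"
begin

abbreviation S :: "'a set" where "S \<equiv> unit_circle q"
abbreviation F :: "'a set" where "F \<equiv> subfield_F q"
abbreviation form :: "'a \<Rightarrow> 'a \<Rightarrow> 'a" where "form \<equiv> form_K q"

section \<open>Arithmetic in characteristic 2\<close>

lemma q_ge_2: "q \<ge> 2" and even_q: "even q"
proof -
  have "card {0, 1 :: 'a} \<le> CARD('a)"
    by (intro card_mono) auto
  then have "m \<noteq> 0"
    using card_K q_eq by (intro notI) simp
  then show "q \<ge> 2" "even q"
    using q_eq self_le_power[of 2 m] by auto
qed

lemma CHAR_K: "CHAR('a) = 2"
proof -
  have "CHAR('a) > 0"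
    by (simp add: finite_imp_CHAR_pos)
  then have "prime CHAR('a)"
    by (rule prime_CHAR_semidom)
  moreover have "CHAR('a) dvd 2 ^ (m * 2)"
    using of_nat_card_finite_field[where 'a = 'a]
    by (simp only: of_nat_eq_0_iff_char_dvd card_K q_eq power_mult)
  ultimately show ?thesis
    by (metis prime_dvd_power primes_dvd_imp_eq two_is_prime_nat)
qed

text \<open>Turns parities of cardinalities and binomial coefficients into equations in
  \<open>K\<close>.\<close>

lemma of_nat_K: "(of_nat n :: 'a) = (if even n then 0 else 1)"
proof -
  have even: "of_nat n = (0::'a) \<longleftrightarrow> even n" for n
    by (simp add: of_nat_eq_0_iff_char_dvd CHAR_K)
  show ?thesis
  proof (cases "even n")
    case False
    then have "of_nat (n - 1) = (0::'a)" "n > 0"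
      by (auto simp: even odd_pos)
    then show ?thesis
      using False by (cases n) auto
  qed (simp add: even)
qed

lemma add_self_K [simp]: "x + x = (0::'a)"
proof -
  have "x + x = of_nat 2 * x"
    by simp
  then show ?thesis
    by (simp add: of_nat_K del: of_nat_numeral)
qed

lemma add_eq_0_iff_K: "x + y = 0 \<longleftrightarrow> x = (y::'a)"
  using add_self_K[of y] by (metis add_right_cancel)

lemma sum_power_q: "(\<Sum>i\<in>A. f i) ^ q = (\<Sum>i\<in>A. f i ^ q :: 'a)"
  by (intro freshmans_dream_sum') (auto simp: CHAR_K q_eq)

lemma add_power_q: "(x + y) ^ q = x ^ q + (y ^ q :: 'a)"
  by (intro freshmans_dream') (auto simp: CHAR_K q_eq)

lemma power_q_q: "(x ^ q) ^ q = (x::'a)"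
proof (cases "x = 0")
  case False
  have "x ^ CARD('a) = x * x ^ (CARD('a) - 1)"
    using q_ge_2 by (simp add: card_K flip: power_Suc)
  then show ?thesis
    using finite_field_power_card_minus_one[OF False]
    by (simp add: card_K power2_eq_square power_mult)
qed (use q_ge_2 in auto)

lemma square_inject_K: "x ^ 2 = y ^ 2 \<longleftrightarrow> x = (y::'a)"
proof -
  have "(x + y) ^ 2 = x ^ 2 + y ^ 2"
    by (intro freshmans_dream) (auto simp: CHAR_K)
  then show ?thesis
    by (metis add_eq_0_iff_K power_eq_0_iff pos2)
qed

lemma order_K: "(q + 1) * (q - 1) = CARD('a) - 1" "(q - 1) * (q + 1) = CARD('a) - 1"
  using q_ge_2 by (simp_all add: card_K power2_eq_square algebra_simps)

lemma S_altdef: "S = {x. x ^ (q + 1) = 1}"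
  by (simp add: unit_circle_def)

lemma card_S: "card S = q + 1"
  unfolding S_altdef by (rule card_roots_of_unity_finite_field[OF order_K(1)])

lemma in_S_iff: "u \<in> S \<longleftrightarrow> u * u ^ q = 1"
  by (simp add: unit_circle_def)

lemma S_nonzero: "u \<in> S \<Longrightarrow> u \<noteq> 0"
  by (auto simp: in_S_iff)

lemma in_F_iff: "x \<in> F \<longleftrightarrow> x ^ q = x"
  by (simp add: subfield_F_def)

lemma F_mult: "x \<in> F \<Longrightarrow> y \<in> F \<Longrightarrow> x * y \<in> F"
  by (simp add: in_F_iff power_mult_distrib)

text \<open>Makes the results on roots of unity available for \<open>F\<close> with
  \<open>d = q - 1\<close>.\<close>

lemma in_F_nonzero_iff: "x \<in> F - {0} \<longleftrightarrow> x ^ (q - 1) = 1"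
proof -
  have "x ^ q = x * x ^ (q - 1)"
    using q_ge_2 by (cases q) auto
  then show ?thesis
    using q_ge_2 by (auto simp: in_F_iff power_0_left)
qed

section \<open>The bilinear form and the directions of lines\<close>

lemma form_eq: "form x y = x * y ^ q + x ^ q * y"
  by (simp add: form_K_def conj_K_def)

lemma form_in_F: "form x y \<in> F"
  by (simp add: in_F_iff form_eq add_power_q power_mult_distrib power_q_q add.commute)

lemma form_add_right: "form x (y + z) = form x y + form x z"
  by (simp add: form_eq add_power_q algebra_simps)

lemma form_scale_right: "r \<in> F \<Longrightarrow> form x (y * r) = r * form x y"
  by (simp add: form_eq in_F_iff power_mult_distrib algebra_simps)

lemma form_0_right [simp]: "form x 0 = 0"
  using q_ge_2 by (simp add: form_eq)

lemma form_eq_iff: "form u x = form u y \<longleftrightarrow> form u (x + y) = 0"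
  by (simp add: form_add_right add_eq_0_iff_K)

lemma form_eq_0_iff:
  assumes "u \<in> S" "d \<noteq> 0"
  shows "form u d = 0 \<longleftrightarrow> u ^ 2 = d / d ^ q"
proof -
  have "form u d = 0 \<longleftrightarrow> u * d ^ q = u ^ q * d"
    by (simp add: form_eq add_eq_0_iff_K)
  also have "\<dots> \<longleftrightarrow> u * (u * d ^ q) = u * (u ^ q * d)"
    using S_nonzero[OF assms(1)] by simp
  also have "u * (u ^ q * d) = d"
    using assms(1) by (simp add: in_S_iff flip: mult.assoc)
  finally show ?thesis
    using assms(2) by (simp add: field_simps power2_eq_square)
qed

lemma form_S_eq_0_iff:
  assumes "u \<in> S" "v \<in> S"
  shows "form u v = 0 \<longleftrightarrow> u = v"
proof -
  have "v ^ 2 * v ^ q = v"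
    using assms(2) by (simp add: in_S_iff power2_eq_square mult.assoc)
  then have "v / v ^ q = v ^ 2"
    using S_nonzero[OF assms(2)] by (simp add: field_simps)
  then show ?thesis
    using assms S_nonzero by (simp add: form_eq_0_iff square_inject_K)
qed

text \<open>Squaring is injective, hence bijective, on the finite set \<open>S\<close>, so
  \<open>d / d ^ q\<close> has exactly one square root there.\<close>

lemma ex1_direction:
  assumes "d \<noteq> 0"
  shows "\<exists>!u. u \<in> S \<and> form u d = 0"
proof -
  have "(\<lambda>u. u ^ 2) ` S \<subseteq> S"
    by (auto simp: in_S_iff simp flip: power_mult_distrib power_mult)
      (simp add: mult.commute[of 2] power_mult flip: power_mult_distrib)
  then have "(\<lambda>u. u ^ 2) ` S = S"
    by (rule endo_inj_surj[rotated]) (auto simp: inj_on_def square_inject_K)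
  moreover have "d / d ^ q \<in> S"
    using assms by (simp add: in_S_iff power_divide power_q_q)
  ultimately obtain u where "u \<in> S" "u ^ 2 = d / d ^ q"
    by force
  then show ?thesis
    using assms by (metis form_eq_0_iff square_inject_K)
qed

text \<open>In characteristic 2 the sum of two distinct points is their difference, so
  \<open>direction (x + y)\<close> is the parameter \<open>u\<close> of the line joining
  \<open>x\<close> and \<open>y\<close>.\<close>

definition direction :: "'a \<Rightarrow> 'a" where
  "direction d = (THE u. u \<in> S \<and> form u d = 0)"

lemma direction_in_S: "x \<noteq> y \<Longrightarrow> direction (x + y) \<in> S"
  using theI'[OF ex1_direction, of "x + y"] by (simp add: direction_def add_eq_0_iff_K)

lemma direction_eq_iff:
  assumes "x \<noteq> y" "u \<in> S"
  shows "direction (x + y) = u \<longleftrightarrow> form u x = form u y"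
proof -
  have nz: "x + y \<noteq> 0"
    using assms(1) by (simp add: add_eq_0_iff_K)
  have "form (direction (x + y)) (x + y) = 0"
    using theI'[OF ex1_direction, OF nz] by (simp add: direction_def)
  then show ?thesis
    using ex1_direction[OF nz] direction_in_S[OF assms(1)] assms(2) by (auto simp: form_eq_iff)
qed

lemma bij_direction:
  assumes H: "card H = q + 2" "x \<in> H"
  shows "inj_on (\<lambda>y. direction (x + y)) (H - {x}) \<longleftrightarrow> (\<lambda>y. direction (x + y)) ` (H - {x}) = S"
proof -
  let ?f = "\<lambda>y. direction (x + y)"
  have card: "card (H - {x}) = card S"
    using H by (simp add: card_S)
  have sub: "?f ` (H - {x}) \<subseteq> S"
    by (auto intro!: direction_in_S)
  show ?thesis
    using card sub by (metis card_image card_subset_eq eq_card_imp_inj_on finite)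
qed

lemma mem_line_iff: "x \<in> line q u \<mu> \<longleftrightarrow> form u x = \<mu>"
  by (simp add: line_def add_eq_0_iff_K)

text \<open>Through a point \<open>x\<close> of \<open>H\<close> there are \<open>q + 1\<close> lines, and \<open>H\<close> has \<open>q + 1\<close> further
  points. So no two of these points lie on the same line through \<open>x\<close> if and only if every line
  through \<open>x\<close> contains one of them.\<close>

lemma hyperoval_iff_even:
  assumes H: "card H = q + 2"
  shows "hyperoval q H \<longleftrightarrow> (\<forall>u\<in>S. \<forall>\<mu>\<in>F. even (card {x \<in> H. form u x = \<mu>}))"
proof
  assume hyp: "hyperoval q H"
  have inj: "inj_on (\<lambda>y. direction (x + y)) (H - {x})" if x: "x \<in> H" for x
  proof (rule inj_onI)
    fix y z assume yz: "y \<in> H - {x}" "z \<in> H - {x}" "direction (x + y) = direction (x + z)"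
    define u where "u = direction (x + y)"
    have u: "u \<in> S"
      using yz by (auto simp: u_def intro!: direction_in_S)
    have "form u x = form u y" "form u x = form u z"
      using u yz direction_eq_iff[of x y u] direction_eq_iff[of x z u] by (auto simp: u_def)
    then have "x \<in> line q u (form u x)" "y \<in> line q u (form u x)" "z \<in> line q u (form u x)"
      by (simp_all add: mem_line_iff)
    moreover have "line q u (form u x) \<in> lines q"
      using u form_in_F by (auto simp: lines_def)
    ultimately show "y = z"
      using hyp yz x unfolding hyperoval_def by blast
  qed
  show "\<forall>u\<in>S. \<forall>\<mu>\<in>F. even (card {x \<in> H. form u x = \<mu>})"
  proof (intro ballI)
    fix u \<mu> assume u: "u \<in> S"
    show "even (card {x \<in> H. form u x = \<mu>})"
    proof (cases "{x \<in> H. form u x = \<mu>} = {}")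
      case False
      then obtain x where x: "x \<in> H" "form u x = \<mu>"
        by auto
      \<comment> \<open>Surjectivity supplies a second point on the line, injectivity forbids a
        third; the count is exactly 2.\<close>
      obtain y where y: "y \<in> H - {x}" "direction (x + y) = u"
        using inj[OF x(1)] bij_direction[OF H x(1)] u by (metis (no_types, lifting) imageE)
      have "z = y" if z: "z \<in> H - {x}" "form u z = \<mu>" for z
        using inj_onD[OF inj[OF x(1)], of z y] z x y direction_eq_iff[of x z u] u by auto
      moreover have "form u y = \<mu>"
        using x y direction_eq_iff[of x y u] u by auto
      ultimately have "{x \<in> H. form u x = \<mu>} = {x, y}"
        using x y(1) by blast
      then show ?thesis
        using y(1) by (auto simp: card_insert_if)
    qed (simp only: card.empty even_zero)
  qed
next
  assume even: "\<forall>u\<in>S. \<forall>\<mu>\<in>F. even (card {x \<in> H. form u x = \<mu>})"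
  have inj: "inj_on (\<lambda>y. direction (x + y)) (H - {x})" if x: "x \<in> H" for x
  proof -
    have "\<exists>y\<in>H - {x}. direction (x + y) = u" if u: "u \<in> S" for u
    proof (rule ccontr)
      assume no: "\<not> ?thesis"
      have "y = x" if "y \<in> H" "form u y = form u x" for y
        using no that u direction_eq_iff[of x y u] by auto
      with x have "{y \<in> H. form u y = form u x} = {x}"
        by blast
      then have "odd (card {y \<in> H. form u y = form u x})"
        by simp
      then show False
        using even u form_in_F by blast
    qed
    then have "(\<lambda>y. direction (x + y)) ` (H - {x}) = S"
      by (force intro!: direction_in_S)
    then show ?thesis
      using bij_direction[OF H x] by simp
  qed
  show "hyperoval q H"
    unfolding hyperoval_def
  proof (intro conjI H ballI impI notI)
    fix x y z assume xyz: "x \<in> H" "y \<in> H" "z \<in> H" "x \<noteq> y \<and> y \<noteq> z \<and> x \<noteq> z"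
      and "\<exists>L\<in>lines q. x \<in> L \<and> y \<in> L \<and> z \<in> L"
    then obtain u \<mu> where "u \<in> S" "form u x = \<mu>" "form u y = \<mu>" "form u z = \<mu>"
      by (auto simp: lines_def mem_line_iff)
    then have "direction (x + y) = direction (x + z)"
      using xyz direction_eq_iff[of x y u] direction_eq_iff[of x z u] by simp
    then show False
      using inj_onD[OF inj[OF xyz(1)], of y z] xyz by auto
  qed
qed

section \<open>Parity of fibres through power sums\<close>

text \<open>For \<open>x\<close> and \<open>y\<close> distinct the sum is (x^q - y^q) / (x - y) with
  x^q = x and y^q = y; for \<open>x = y\<close> it consists of \<open>q\<close> equal terms, and
  \<open>q\<close> is even.\<close>

lemma power_sum_indicator:
  assumes "x \<in> F" "y \<in> F"
  shows "(\<Sum>k<q. y ^ (q - Suc k) * x ^ k) = (if x = y then 0 else 1)"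
proof (cases "x = y")
  case True
  have "(\<Sum>k<q. y ^ (q - Suc k) * x ^ k) = (\<Sum>k<q. y ^ (q - 1))"
    unfolding True by (intro sum.cong) (auto simp flip: power_add)
  then show ?thesis
    using True even_q by (simp add: of_nat_K)
next
  case False
  have "(x - y) * (\<Sum>k<q. y ^ (q - Suc k) * x ^ k) = x ^ q - y ^ q"
    by (rule power_diff_sumr2[symmetric])
  also have "\<dots> = x - y"
    using assms by (simp add: in_F_iff)
  finally show ?thesis
    using False by simp
qed

text \<open>Modulo 2, the number of \<open>v\<close> with \<open>a v \<noteq> \<mu>\<close> is a polynomial in \<open>\<mu>\<close> of degree less than
  \<open>q\<close> whose coefficients are the power sums of \<open>a\<close>.\<close>

lemma even_fibres_iff_power_sums:
  fixes a :: "'i \<Rightarrow> 'a"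
  assumes A: "finite A" "odd (card A)" "even (card {v \<in> A. a v \<noteq> 0})"
    and a: "\<And>v. v \<in> A \<Longrightarrow> a v \<in> F"
  shows "(\<forall>\<mu>\<in>F - {0}. even (card {v \<in> A. a v = \<mu>})) \<longleftrightarrow>
    (\<forall>k\<in>{1..q - 2}. (\<Sum>v\<in>A. a v ^ k) = 0)"
proof -
  define P where "P k = (\<Sum>v\<in>A. a v ^ k)" for k
  have P0: "P 0 = 1"
    using A by (simp add: P_def of_nat_K)
  \<comment> \<open>On \<open>F\<close> the power \<open>q - 1\<close> is the indicator of the
    nonzero elements, whose number is even by assumption.\<close>
  have "P (q - 1) = (\<Sum>v\<in>A. if a v \<noteq> 0 then 1 else 0)"
    unfolding P_def using a in_F_nonzero_iff q_ge_2 by (intro sum.cong) (auto simp: power_0_left)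
  also have "\<dots> = of_nat (card {v \<in> A. a v \<noteq> 0})"
    using A by (simp add: sum.If_cases Int_def)
  finally have Pq: "P (q - 1) = 0"
    using A by (simp add: of_nat_K)
  have even_iff: "even (card {v \<in> A. a v = \<mu>}) \<longleftrightarrow> (\<Sum>k=1..q - 2. P k * \<mu> ^ (q - Suc k)) = 0"
    if \<mu>: "\<mu> \<in> F - {0}" for \<mu>
  proof -
    have "card A = card ({v \<in> A. a v = \<mu>} \<union> {v \<in> A. a v \<noteq> \<mu>})"
      by (intro arg_cong[where f = card]) auto
    also have "\<dots> = card {v \<in> A. a v = \<mu>} + card {v \<in> A. a v \<noteq> \<mu>}"
      using A by (intro card_Un_disjoint) auto
    finally have "even (card {v \<in> A. a v = \<mu>}) \<longleftrightarrow> odd (card {v \<in> A. a v \<noteq> \<mu>})"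
      using A by presburger
    also have "\<dots> \<longleftrightarrow> of_nat (card {v \<in> A. a v \<noteq> \<mu>}) = (1::'a)"
      by (simp add: of_nat_K)
    also have "of_nat (card {v \<in> A. a v \<noteq> \<mu>}) = (\<Sum>v\<in>A. if a v = \<mu> then 0 else (1::'a))"
      using A by (simp add: sum.If_cases Int_def)
    also have "\<dots> = (\<Sum>v\<in>A. \<Sum>k<q. \<mu> ^ (q - Suc k) * a v ^ k)"
      using a \<mu> by (intro sum.cong) (auto simp: power_sum_indicator)
    also have "\<dots> = (\<Sum>k<q. P k * \<mu> ^ (q - Suc k))"
      by (subst sum.swap) (simp add: P_def sum_distrib_left mult.commute)
    also have "\<dots> = (\<Sum>k=0..q - 1. P k * \<mu> ^ (q - Suc k))"
      using q_ge_2 by (intro sum.cong) auto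
    \<comment> \<open>The term for \<open>k = 0\<close> equals 1 and accounts for the parity shift;
      the term for \<open>k = q - 1\<close> vanishes.\<close>
    also have "\<dots> = P 0 * \<mu> ^ (q - 1) + (\<Sum>k=1..q - 1. P k * \<mu> ^ (q - Suc k))"
      by (simp add: sum.atLeast_Suc_atMost)
    also have "(\<Sum>k=1..q - 1. P k * \<mu> ^ (q - Suc k)) = (\<Sum>k=1..q - 2. P k * \<mu> ^ (q - Suc k))"
    proof (rule sum.mono_neutral_right)
      have "{1..q - 1} - {1..q - 2} \<subseteq> {q - 1}"
        by auto
      then show "\<forall>k\<in>{1..q - 1} - {1..q - 2}. P k * \<mu> ^ (q - Suc k) = 0"
        using Pq by auto
    qed auto
    also have "P 0 * \<mu> ^ (q - 1) = 1"
      using in_F_nonzero_iff[of \<mu>] \<mu> P0 by simp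
    finally show ?thesis
      by simp
  qed
  show ?thesis
    unfolding P_def[symmetric]
  proof (intro iffI ballI)
    fix k assume even: "\<forall>\<mu>\<in>F - {0}. even (card {v \<in> A. a v = \<mu>})" and k: "k \<in> {1..q - 2}"
    show "P k = 0"
    \<comment> \<open>The polynomial vanishes on all (q-1)-th roots of unity, and its exponents lie
      between 1 and \<open>q - 2\<close>, so they are distinct modulo \<open>q - 1\<close>.\<close>
    proof (rule independent_powers_roots_of_unity[OF order_K(2), where I = "{1..q - 2}"
          and n = "\<lambda>k. q - Suc k"])
      fix i j assume ij: "i \<in> {1..q - 2}" "j \<in> {1..q - 2}"
        "int (q - 1) dvd int (q - Suc i) - int (q - Suc j)"
      have "q - Suc i = q - Suc j"
        using ij by (intro eq_if_int_dvd_diff[OF ij(3)]) auto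
      then show "i = j"
        using ij by auto
    next
      fix x :: 'a assume "x ^ (q - 1) = 1"
      then have "x \<in> F - {0}"
        by (simp only: in_F_nonzero_iff)
      then show "(\<Sum>k=1..q - 2. P k * x ^ (q - Suc k)) = 0"
        using even even_iff[of x] by simp
    qed (use k in auto)
  next
    fix \<mu> assume "\<forall>k\<in>{1..q - 2}. P k = 0" and \<mu>: "\<mu> \<in> F - {0}"
    then show "even (card {v \<in> A. a v = \<mu>})"
      unfolding even_iff[OF \<mu>] by simp
  qed
qed

end


section \<open>The point set of a polynomial\<close>

locale circle_poly = even_square_field q m K
  for q m :: nat and K :: "'a::{field,finite} itself" +
  fixes \<rho> :: "'a poly"
  assumes poly_S: "u \<in> S \<Longrightarrow> poly \<rho> u \<in> F - {0}"
begin

abbreviation H :: "'a set" where "H \<equiv> point_set q \<rho>"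

lemma H_altdef: "H = insert 0 ((\<lambda>u. u * poly \<rho> u) ` S)"
  by (auto simp: point_set_def)

lemma form_point: "v \<in> S \<Longrightarrow> form u (v * poly \<rho> v) = poly \<rho> v * form u v"
  using poly_S by (intro form_scale_right) auto

text \<open>Pairing equal points with \<open>u\<close> gives \<open>form u v = 0\<close>, because
  \<open>form u u = 0\<close> and \<open>poly \<rho> v\<close> is nonzero.\<close>

lemma inj_on_point: "inj_on (\<lambda>u. u * poly \<rho> u) S"
proof (rule inj_onI)
  fix u v assume uv: "u \<in> S" "v \<in> S" "u * poly \<rho> u = v * poly \<rho> v"
  then have "poly \<rho> u * form u u = poly \<rho> v * form u v"
    by (metis form_point)
  then show "u = v"
    using uv poly_S[of v] form_S_eq_0_iff[of u u] form_S_eq_0_iff[of u v] by auto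
qed

lemma point_nonzero: "u \<in> S \<Longrightarrow> u * poly \<rho> u \<noteq> 0"
  using poly_S S_nonzero by auto

lemma card_H: "card H = q + 2"
  unfolding H_altdef
  using point_nonzero by (subst card_insert_disjoint) (auto simp: card_image[OF inj_on_point] card_S)

lemma even_line_iff:
  assumes u: "u \<in> S"
  shows "(\<forall>\<mu>\<in>F. even (card {x \<in> H. form u x = \<mu>})) \<longleftrightarrow>
    (\<forall>\<mu>\<in>F - {0}. even (card {v \<in> S. poly \<rho> v * form u v = \<mu>}))"
proof -
  have "form u (v * poly \<rho> v) = 0 \<longleftrightarrow> v = u" if "v \<in> S" for v
    using that u poly_S[of v] by (auto simp: form_point form_S_eq_0_iff)
  then have "{x \<in> H. form u x = 0} = {0, u * poly \<rho> u}"
    using u unfolding H_altdef by auto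
  then have "card {x \<in> H. form u x = 0} = 2"
    using point_nonzero[OF u] by simp
  moreover have "card {x \<in> H. form u x = \<mu>} = card {v \<in> S. poly \<rho> v * form u v = \<mu>}"
    if "\<mu> \<noteq> 0" for \<mu>
  proof -
    have "{x \<in> H. form u x = \<mu>} = (\<lambda>v. v * poly \<rho> v) ` {v \<in> S. poly \<rho> v * form u v = \<mu>}"
      using that unfolding H_altdef by (auto simp: form_point)
    then show ?thesis
      using inj_on_subset[OF inj_on_point] by (simp add: card_image)
  qed
  ultimately have "even (card {x \<in> H. form u x = \<mu>}) \<longleftrightarrow>
      \<mu> = 0 \<or> even (card {v \<in> S. poly \<rho> v * form u v = \<mu>})" for \<mu>
    by (cases "\<mu> = 0") simp_all
  then show ?thesis
    by simp blast
qed

lemma hyperoval_iff_power_sums: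
  "hyperoval q H \<longleftrightarrow> (\<forall>u\<in>S. \<forall>k\<in>{1..q - 2}. (\<Sum>v\<in>S. (poly \<rho> v * form u v) ^ k) = 0)"
proof -
  have "(\<forall>\<mu>\<in>F - {0}. even (card {v \<in> S. poly \<rho> v * form u v = \<mu>})) \<longleftrightarrow>
    (\<forall>k\<in>{1..q - 2}. (\<Sum>v\<in>S. (poly \<rho> v * form u v) ^ k) = 0)" if u: "u \<in> S" for u
  proof (rule even_fibres_iff_power_sums)
    \<comment> \<open>This leaves \<open>q\<close> nonzero values, an even number, among the odd
      number \<open>q + 1\<close>.\<close>
    have "{v \<in> S. poly \<rho> v * form u v \<noteq> 0} = S - {u}"
      using u poly_S by (auto simp: form_S_eq_0_iff)
    then show "even (card {v \<in> S. poly \<rho> v * form u v \<noteq> 0})"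
      using u even_q by (simp add: card_S)
  qed (use poly_S even_q in \<open>auto simp: card_S F_mult form_in_F\<close>)
  then show ?thesis
    by (simp add: hyperoval_iff_even[OF card_H] even_line_iff)
qed

section \<open>Moments on the unit circle and coefficients modulo x^(q+1) - 1\<close>

text \<open>Only \<open>t\<close> modulo \<open>q + 1\<close> matters. Since q = -1 modulo q + 1, a
  factor \<open>q\<close> in the exponent encodes a negative sign: \<open>q * i + (k - i)\<close>
  stands for k - 2i.\<close>

definition moment :: "nat \<Rightarrow> nat \<Rightarrow> 'a" where
  "moment k t = (\<Sum>v\<in>S. poly \<rho> v ^ k * v ^ t)"

lemma moment_eq_of_dvd:
  assumes "int (q + 1) dvd int s - int t"
  shows "moment k s = moment k t"
  unfolding moment_def
proof (rule sum.cong)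
  fix v :: 'a assume "v \<in> S"
  then have "v ^ s = v ^ t"
    using assms unfolding S_altdef by (intro power_eq_of_dvd[of v "q + 1"]) auto
  then show "poly \<rho> v ^ k * v ^ s = poly \<rho> v ^ k * v ^ t"
    by simp
qed simp

lemma moment_power_q: "moment k t ^ q = moment k (q * t)"
proof -
  have "(poly \<rho> v ^ k * v ^ t) ^ q = poly \<rho> v ^ k * v ^ (q * t)" if "v \<in> S" for v
  proof -
    have "(poly \<rho> v ^ k) ^ q = (poly \<rho> v ^ q) ^ k"
      by (simp add: mult.commute flip: power_mult)
    also have "poly \<rho> v ^ q = poly \<rho> v"
      using poly_S[OF that] by (simp add: in_F_iff)
    finally show ?thesis
      by (simp add: power_mult_distrib mult.commute[of q] power_mult)
  qed
  then show ?thesis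
    by (simp add: moment_def sum_power_q)
qed

text \<open>The two exponents are opposite modulo \<open>q + 1\<close>, so the moments are
  conjugate: raising to the power \<open>q\<close> fixes the values of \<open>\<rho>\<close> and
  inverts elements of \<open>S\<close>.\<close>

lemma moment_conj_eq_0_iff:
  assumes "i \<le> k"
  shows "moment k (q * (k - i) + i) = 0 \<longleftrightarrow> moment k (q * i + (k - i)) = 0"
proof -
  obtain n where k: "k = i + n"
    using assms by (auto simp: le_iff_add)
  have "int (q * (q * i + (k - i))) - int (q * (k - i) + i) = int (q + 1) * ((int q - 1) * int i)"
    by (simp add: k algebra_simps)
  then have "moment k (q * (q * i + (k - i))) = moment k (q * (k - i) + i)"
    by (intro moment_eq_of_dvd) (metis dvd_triv_left)
  then have "moment k (q * (k - i) + i) = moment k (q * i + (k - i)) ^ q"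
    by (simp add: moment_power_q)
  then show ?thesis
    using q_ge_2 by simp
qed

text \<open>On \<open>S\<close> the power of \<open>\<rho>\<close> agrees with its remainder, which
  has degree at most \<open>q\<close>. Orthogonality then leaves only the coefficient at
  \<open>j\<close>, multiplied by q + 1 = 1 in \<open>K\<close>.\<close>

lemma moment_eq_coeff:
  assumes j: "j \<le> q" and dvd: "q + 1 dvd j + t"
  shows "moment k t = coeff (\<rho> ^ k mod modulus_poly q) j"
proof -
  define M :: "'a poly" where "M = modulus_poly q"
  define p where "p = \<rho> ^ k mod M"
  have "coeff M (q + 1) = 1"
    by (simp add: M_def modulus_poly_def)
  then have "M \<noteq> 0"
    by auto
  moreover have "degree M \<le> q + 1"
    unfolding M_def modulus_poly_def by (intro degree_diff_le) (auto simp: degree_monom_le)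
  ultimately have "degree p \<le> q"
    using degree_mod_less[of M "\<rho> ^ k"] by (auto simp: p_def)
  then have poly_p: "poly p v = (\<Sum>i\<le>q. coeff p i * v ^ i)" for v
    unfolding poly_altdef by (intro sum.mono_neutral_left) (auto simp: coeff_eq_0)
  have "poly p v = poly \<rho> v ^ k" if "v \<in> S" for v
    using that by (simp add: p_def poly_mod M_def modulus_poly_def poly_monom unit_circle_def)
  then have "moment k t = (\<Sum>v\<in>S. poly p v * v ^ t)"
    by (simp add: moment_def)
  also have "\<dots> = (\<Sum>v\<in>S. \<Sum>i\<le>q. coeff p i * v ^ (i + t))"
    by (simp add: poly_p sum_distrib_right power_add mult.assoc)
  also have "\<dots> = (\<Sum>i\<le>q. coeff p i * (\<Sum>v\<in>S. v ^ (i + t)))"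
    by (subst sum.swap) (simp add: sum_distrib_left)
  also have "\<dots> = (\<Sum>i\<le>q. if i = j then coeff p i else 0)"
  proof (rule sum.cong)
    fix i assume i: "i \<in> {..q}"
    have "q + 1 dvd i + t \<longleftrightarrow> i = j"
    proof
      assume "q + 1 dvd i + t"
      then have "int (q + 1) dvd int (i + t) - int (j + t)"
        using dvd by (intro dvd_diff) (simp_all only: int_dvd_int_iff)
      then show "i = j"
        using i j by (intro eq_if_int_dvd_diff[of "q + 1"]) auto
    qed (use dvd in simp)
    then show "coeff p i * (\<Sum>v\<in>S. v ^ (i + t)) = (if i = j then coeff p i else 0)"
      using even_q unfolding S_altdef sum_power_roots_of_unity[OF order_K(1)] by (simp add: of_nat_K del: of_nat_add of_nat_Suc)
  qed simp
  also have "\<dots> = coeff p j"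
    using j by simp
  finally show ?thesis
    by (simp add: p_def M_def)
qed

lemma power_sum_expansion:
  "(\<Sum>v\<in>S. (poly \<rho> v * form u v) ^ k) =
    (\<Sum>i | i \<le> k \<and> digit_le i k. moment k (q * i + (k - i)) * u ^ (i + q * (k - i)))"
proof -
  have "(u * v ^ q) ^ i * (u ^ q * v) ^ (k - i) = v ^ (q * i + (k - i)) * u ^ (i + q * (k - i))" for v i
    unfolding power_add power_mult power_mult_distrib by (simp only: mult_ac)
  then have "(\<Sum>v\<in>S. (poly \<rho> v * form u v) ^ k) =
    (\<Sum>v\<in>S. \<Sum>i\<le>k. of_nat (k choose i) * (poly \<rho> v ^ k * v ^ (q * i + (k - i))) * u ^ (i + q * (k - i)))"
    unfolding form_eq power_mult_distrib[of "poly _ _"] binomial_ring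
    by (simp only: sum_distrib_left mult_ac)
  also have "\<dots> = (\<Sum>i\<le>k. of_nat (k choose i) * moment k (q * i + (k - i)) * u ^ (i + q * (k - i)))"
    by (subst sum.swap) (simp add: moment_def sum_distrib_left sum_distrib_right)
  also have "\<dots> = (\<Sum>i\<le>k. if digit_le i k
      then moment k (q * i + (k - i)) * u ^ (i + q * (k - i)) else 0)"
    by (intro sum.cong) (simp_all add: of_nat_K flip: odd_choose_iff_digit_le)
  also have "\<dots> = (\<Sum>i | i \<le> k \<and> digit_le i k. moment k (q * i + (k - i)) * u ^ (i + q * (k - i)))"
    by (simp add: sum.If_cases Int_def)
  finally show ?thesis .
qed

text \<open>The exponents of \<open>u\<close> are 2i - k modulo \<open>q + 1\<close>. They are
  distinct because 2 is invertible modulo the odd number \<open>q + 1\<close> and i does not exceed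
  k < q + 1.\<close>

lemma power_sums_eq_0_iff:
  assumes "k \<le> q - 2"
  shows "(\<forall>u\<in>S. (\<Sum>v\<in>S. (poly \<rho> v * form u v) ^ k) = 0) \<longleftrightarrow>
    (\<forall>i\<le>k. digit_le i k \<longrightarrow> moment k (q * i + (k - i)) = 0)"
proof (intro iffI allI impI)
  fix i assume zero: "\<forall>u\<in>S. (\<Sum>v\<in>S. (poly \<rho> v * form u v) ^ k) = 0"
    and i: "i \<le> k" "digit_le i k"
  show "moment k (q * i + (k - i)) = 0"
  proof (rule independent_powers_roots_of_unity[OF order_K(1), where I = "{i. i \<le> k \<and> digit_le i k}"
        and n = "\<lambda>i. i + q * (k - i)" and c = "\<lambda>i. moment k (q * i + (k - i))"])
    fix i j assume ij: "i \<in> {i. i \<le> k \<and> digit_le i k}" "j \<in> {i. i \<le> k \<and> digit_le i k}"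
      "int (q + 1) dvd int (i + q * (k - i)) - int (j + q * (k - j))"
    have "int (i + q * (k - i)) - int (j + q * (k - j)) =
        2 * (int i - int j) - int (q + 1) * (int i - int j)"
      using ij by (simp only: mem_Collect_eq of_nat_add of_nat_mult of_nat_diff) (simp add: algebra_simps)
    then have "int (q + 1) dvd 2 * (int i - int j)"
      using ij(3) by (metis dvd_diff_left_iff dvd_triv_left)
    moreover have "coprime (int (q + 1)) 2"
      using even_q by simp
    ultimately have "int (q + 1) dvd int i - int j"
      by (simp only: coprime_dvd_mult_right_iff)
    then show "i = j"
      using ij assms by (intro eq_if_int_dvd_diff[of "q + 1"]) auto
  next
    fix u :: 'a assume "u ^ (q + 1) = 1"
    then have "(\<Sum>v\<in>S. (poly \<rho> v * form u v) ^ k) = 0"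
      using zero by (simp add: S_altdef)
    then show "(\<Sum>i | i \<le> k \<and> digit_le i k. moment k (q * i + (k - i)) * u ^ (i + q * (k - i))) = 0"
      by (simp only: power_sum_expansion)
  qed (use i in auto)
qed (simp add: power_sum_expansion)

lemma hyperoval_iff_moments:
  "hyperoval q H \<longleftrightarrow> (\<forall>(i, k)\<in>index_set q. moment k (q * i + (k - i)) = 0)"
proof -
  have "(\<forall>i\<le>k. digit_le i k \<longrightarrow> moment k (q * i + (k - i)) = 0) \<longleftrightarrow>
    (\<forall>i. i \<le> (k - 1) div 2 \<and> digit_le i k \<longrightarrow> moment k (q * i + (k - i)) = 0)"
    (is "?all \<longleftrightarrow> ?half") if k: "k \<ge> 1" for k
  proof (intro iffI allI impI)
    fix i assume half: ?half and i: "i \<le> k" "digit_le i k"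
    have sym: "digit_le (k - i) k"
      using i by (metis binomial_symmetric odd_choose_iff_digit_le)
    \<comment> \<open>The upper half follows by conjugation from the lower half; the middle index is
      ruled out by its binary digits.\<close>
    consider "i \<le> (k - 1) div 2" | "k - i \<le> (k - 1) div 2" | "k = 2 * i"
      using i k by linarith
    then show "moment k (q * i + (k - i)) = 0"
    proof cases
      case 1
      then show ?thesis
        using half i by blast
    next
      case 2
      then have "moment k (q * (k - i) + i) = 0"
        using half sym i by fastforce
      then show ?thesis
        using moment_conj_eq_0_iff[OF i(1)] by simp
    next
      case 3
      then show ?thesis
        using i k not_digit_le_double[of i] by simp
    qed
  next
    fix i assume ?all "i \<le> (k - 1) div 2 \<and> digit_le i k"
    then show "moment k (q * i + (k - i)) = 0"
      by auto
  qed
  then show ?thesis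
    unfolding hyperoval_iff_power_sums index_set_def using power_sums_eq_0_iff by fastforce
qed

end

theorem theorem5p4:
  fixes \<rho> :: "'a::{field,finite} poly" and q m :: nat
  assumes "q = 2 ^ m"
    and "CARD('a) = q\<^sup>2"
    and "\<forall>u \<in> unit_circle q. poly \<rho> u \<in> subfield_F q - {0}"
  shows "(hyperoval q (point_set q \<rho>) \<longleftrightarrow>
           (\<forall>(i, k) \<in> index_set q.
              coeff (\<rho> ^ k mod modulus_poly q) (2 * i + (q + 1) - k) = 0))
       \<and> (hyperoval q (point_set q \<rho>) \<longleftrightarrow>
           (\<forall>(i, k) \<in> index_set q.
              coeff (\<rho> ^ k mod modulus_poly q) (k - 2 * i) = 0))"
proof -
  interpret circle_poly q m "TYPE('a)" \<rho>
    using assms by unfold_locales auto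
  have "coeff (\<rho> ^ k mod modulus_poly q) (2 * i + (q + 1) - k) = moment k (q * i + (k - i))"
    "coeff (\<rho> ^ k mod modulus_poly q) (k - 2 * i) = moment k (q * (k - i) + i)"
    "i \<le> k" if "(i, k) \<in> index_set q" for i k
  proof -
    \<comment> \<open>These bounds keep both coefficient indices between 0 and \<open>q\<close> and
      ensure that no subtraction truncates.\<close>
    have ik: "2 * i + 1 \<le> k" "k \<le> q - 2"
      using that by (auto simp: index_set_def)
    then show "i \<le> k"
      by simp
    \<comment> \<open>Each coefficient index is opposite to its moment exponent modulo
      \<open>q + 1\<close>, as \<open>moment_eq_coeff\<close> requires.\<close>
    have "2 * i + (q + 1) - k + (q * i + (k - i)) = (q + 1) * (i + 1)"
      using ik by simp
    moreover have "k - 2 * i + (q * (k - i) + i) = (q + 1) * (k - i)"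
      using ik by (simp only: distrib_right)
    ultimately have dvd: "q + 1 dvd 2 * i + (q + 1) - k + (q * i + (k - i))"
      "q + 1 dvd k - 2 * i + (q * (k - i) + i)"
      by (simp_all only: dvd_triv_left)
    show "coeff (\<rho> ^ k mod modulus_poly q) (2 * i + (q + 1) - k) = moment k (q * i + (k - i))"
      using ik by (intro moment_eq_coeff[OF _ dvd(1), symmetric]) simp
    show "coeff (\<rho> ^ k mod modulus_poly q) (k - 2 * i) = moment k (q * (k - i) + i)"
      using ik by (intro moment_eq_coeff[OF _ dvd(2), symmetric]) simp
  qed
  then show ?thesis
    unfolding hyperoval_iff_moments using moment_conj_eq_0_iff by (auto 0 3)
qed

end
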